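(* Let $n=3k+2$ with $k\ge 0$. Then there exists a lattice-like $1$-PDDS in $\Lambda_n$ all of whose components are isomorphic to $P_2\square P_2$.
   Context: $\Lambda_n$ is the infinite graph with vertex set $\mathbb{Z}^n$ in which two vertices are adjacent iff their Euclidean distance is $1$; $d$ denotes graph distance. For $S$ a set of vertices, $[S]$ is the induced subgraph and $d(v,C)=\min\{d(v,w):w\in C\}$. For $t\ge1$, $S$ is a $t$-perfect distance-dominating set ($t$-PDDS) if for each vertex $v$ there is a unique component $C_v$ of $[S]$ with $d(v,C_v)\le t$, and there is in $C_v$ a unique vertex $w$ with $d(v,w)=d(v,C_v)$. For a subgraph $D$ of $\Lambda_n$ and $z\in\mathbb{Z}^n$, $D+z$ is the translate of $D$ by $z$ (vertices and edges shifted by $z$). A $t$-PDDS $R$ all of whose components are isomorphic to a fixed graph is lattice-like if, for a component $D$ of $R$, there is a lattice $L$ (a subgroup of $(\mathbb{Z}^n,+)$) such that $D'$ is a component of $R$ if and only if $D'=D+z$ for some $z\in L$. $P_2$ is the path on 2 vertices and $\square$ is the Cartesian product. *)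

theory Defs
  imports "HOL-Analysis.Analysis" "HOL-Library.Extended_Nat"
begin

record 'a sgraph =
  verts :: "'a set"
  edges :: "'a set set"

definition subgraph :: "'a sgraph \<Rightarrow> 'a sgraph \<Rightarrow> bool" where
  "subgraph H G \<longleftrightarrow>
     verts H \<subseteq> verts G \<and> edges H \<subseteq> edges G \<and> (\<forall>e\<in>edges H. e \<subseteq> verts H)"

definition induced_subgraph :: "'a sgraph \<Rightarrow> 'a set \<Rightarrow> 'a sgraph" where
  "induced_subgraph G S = \<lparr>verts = S \<inter> verts G, edges = {e \<in> edges G. e \<subseteq> S}\<rparr>"

definition walk_betw :: "'a sgraph \<Rightarrow> 'a \<Rightarrow> 'a list \<Rightarrow> 'a \<Rightarrow> bool" where
  "walk_betw G u p v \<longleftrightarrow>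
     p \<noteq> [] \<and> hd p = u \<and> last p = v \<and> set p \<subseteq> verts G \<and>
     successively (\<lambda>x y. {x, y} \<in> edges G) p"

text \<open>A walk is given by its vertices, so its length is one less than the length of the list.
  The distance between vertices not joined by a walk is \<open>\<infinity>\<close>.\<close>

definition gdist :: "'a sgraph \<Rightarrow> 'a \<Rightarrow> 'a \<Rightarrow> enat" where
  "gdist G u v = (INF p \<in> {p. walk_betw G u p v}. enat (length p - 1))"

text \<open>For nonempty \<open>C\<close> this infimum is a minimum, as \<^typ>\<open>enat\<close> is well-ordered.\<close>

definition gdist_set :: "'a sgraph \<Rightarrow> 'a \<Rightarrow> 'a set \<Rightarrow> enat" where
  "gdist_set G v C = (INF w \<in> C. gdist G v w)"

definition gconnected :: "'a sgraph \<Rightarrow> bool" where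
  "gconnected G \<longleftrightarrow>
     verts G \<noteq> {} \<and> (\<forall>u\<in>verts G. \<forall>v\<in>verts G. \<exists>p. walk_betw G u p v)"

definition is_component :: "'a sgraph \<Rightarrow> 'a sgraph \<Rightarrow> bool" where
  "is_component G C \<longleftrightarrow>
     subgraph C G \<and> gconnected C \<and>
     (\<forall>H. subgraph H G \<and> gconnected H \<and> subgraph C H \<longrightarrow> H = C)"

definition graph_iso :: "'a sgraph \<Rightarrow> 'b sgraph \<Rightarrow> bool" where
  "graph_iso G H \<longleftrightarrow>
     (\<exists>f. bij_betw f (verts G) (verts H) \<and>
          (\<forall>u\<in>verts G. \<forall>v\<in>verts G. {u, v} \<in> edges G \<longleftrightarrow> {f u, f v} \<in> edges H))"

definition path_graph :: "nat \<Rightarrow> nat sgraph" where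
  "path_graph m = \<lparr>verts = {..<m}, edges = {{i, Suc i} | i. Suc i < m}\<rparr>"

definition cartesian_product :: "'a sgraph \<Rightarrow> 'b sgraph \<Rightarrow> ('a \<times> 'b) sgraph"
    (infixr \<open>\<box>\<close> 70) where
  "G \<box> H =
     \<lparr>verts = verts G \<times> verts H,
      edges = {{(a, b), (a, b')} | a b b'. a \<in> verts G \<and> {b, b'} \<in> edges H} \<union>
              {{(a, b), (a', b)} | a a' b. {a, a'} \<in> edges G \<and> b \<in> verts H}\<rparr>"

definition real_vec :: "int ^ 'n \<Rightarrow> real ^ 'n" where
  "real_vec u = (\<chi> i. real_of_int (u $ i))"

definition Lambda :: "(int ^ 'n::finite) sgraph" (\<open>\<Lambda>\<close>) where
  "\<Lambda> = \<lparr>verts = UNIV, edges = {{u, v} | u v. dist (real_vec u) (real_vec v) = 1}\<rparr>"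

definition PDDS :: "nat \<Rightarrow> 'a sgraph \<Rightarrow> 'a set \<Rightarrow> bool" where
  "PDDS t G S \<longleftrightarrow>
     S \<subseteq> verts G \<and>
     (\<forall>v\<in>verts G.
        (\<exists>!C. is_component (induced_subgraph G S) C \<and> gdist_set G v (verts C) \<le> enat t) \<and>
        (\<forall>C. is_component (induced_subgraph G S) C \<and> gdist_set G v (verts C) \<le> enat t \<longrightarrow>
           (\<exists>!w. w \<in> verts C \<and> gdist G v w = gdist_set G v (verts C))))"

definition translate :: "'a::ab_group_add sgraph \<Rightarrow> 'a \<Rightarrow> 'a sgraph" where
  "translate D z =
     \<lparr>verts = (\<lambda>x. x + z) ` verts D, edges = (\<lambda>e. (\<lambda>x. x + z) ` e) ` edges D\<rparr>"

definition is_lattice :: "'a::ab_group_add set \<Rightarrow> bool" where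
  "is_lattice L \<longleftrightarrow>
     0 \<in> L \<and> (\<forall>x\<in>L. \<forall>y\<in>L. x + y \<in> L) \<and> (\<forall>x\<in>L. - x \<in> L)"

definition lattice_like :: "(int ^ 'n::finite) set \<Rightarrow> bool" where
  "lattice_like R \<longleftrightarrow>
     (\<exists>D L. is_component (induced_subgraph \<Lambda> R) D \<and> is_lattice L \<and>
        (\<forall>D'. is_component (induced_subgraph \<Lambda> R) D' \<longleftrightarrow> (\<exists>z\<in>L. D' = translate D z)))"

end

theory Submission
  imports Defs
begin

text \<open>
  Let \<open>Q\<close> be a unit square in the plane of two coordinates \<open>i1\<close>, \<open>i2\<close>. Its closed neighbourhood has
  \<open>4 (2 n - 1) = 12 (2 k + 1)\<close> vertices, so it suffices to find a homomorphism from \<open>\<int>\<^sup>n\<close> to a group of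
  that order which is bijective on this neighbourhood: the translates of \<open>Q\<close> by the kernel are then
  the components of the required set. Such a homomorphism into
  \<open>\<int>/4 \<times> \<int>/3 \<times> \<int>/(2 k + 1)\<close> sends the two unit vectors of the plane to \<open>(1, 0, 0)\<close> and
  \<open>(2, 1, 0)\<close> and the remaining \<open>3 k\<close> unit vectors to the elements \<open>(0, c, j)\<close> with \<open>0 \<le> c \<le> 2\<close> and
  \<open>1 \<le> j \<le> k\<close>. The twelve vertices of the neighbourhood in the plane cover the elements with third coordinate \<open>0\<close>; since
  \<open>Q\<close> maps bijectively onto the first factor, the three values of \<open>c\<close> make the neighbours in
  directions \<open>(c, \<plusminus>j)\<close> cover the elements with third coordinate \<open>\<plusminus>j\<close>.
\<close>

subsection \<open>Distances and components in graphs\<close>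

text \<open>\<open>enat\<close> is well-ordered, so an infimum over a nonempty set of walks is
  attained; over no walks it is infinite and exceeds \<open>enat m\<close>.\<close>

lemma gdist_le_iff:
  "gdist G u v \<le> enat m \<longleftrightarrow> (\<exists>p. walk_betw G u p v \<and> length p - 1 \<le> m)"
proof
  assume le: "gdist G u v \<le> enat m"
  let ?A = "(\<lambda>p. enat (length p - 1)) ` {p. walk_betw G u p v}"
  have "?A \<noteq> {}"
  proof
    assume "?A = {}"
    then have "gdist G u v = \<infinity>"
      unfolding gdist_def by (simp only: Inf_enat_def simp_thms if_True)
    with le show False
      by simp
  qed
  then have "Inf ?A \<in> ?A"
    by (metis (mono_tags) Inf_enat_def LeastI_ex ex_in_conv)
  then show "\<exists>p. walk_betw G u p v \<and> length p - 1 \<le> m"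
    using le by (auto simp: gdist_def)
next
  assume "\<exists>p. walk_betw G u p v \<and> length p - 1 \<le> m"
  then obtain p where p: "walk_betw G u p v" "length p - 1 \<le> m"
    by blast
  then have "gdist G u v \<le> enat (length p - 1)"
    by (auto simp: gdist_def intro!: INF_lower)
  also have "\<dots> \<le> enat m"
    using p by simp
  finally show "gdist G u v \<le> enat m" .
qed

lemma walk_betw_singleton: "walk_betw G u [x] v \<longleftrightarrow> u = x \<and> v = x \<and> x \<in> verts G"
  by (auto simp: walk_betw_def)

lemma walk_betw_pair:
  "walk_betw G u [x, y] v \<longleftrightarrow> u = x \<and> v = y \<and> {x, y} \<subseteq> verts G \<and> {x, y} \<in> edges G"
  by (auto simp: walk_betw_def)

lemma gdist_eq_0_iff:
  assumes "u \<in> verts G"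
  shows "gdist G u v = 0 \<longleftrightarrow> u = v"
proof -
  have "gdist G u v = 0 \<longleftrightarrow> gdist G u v \<le> enat 0"
    by (simp add: zero_enat_def[symmetric])
  also have "\<dots> \<longleftrightarrow> (\<exists>p. walk_betw G u p v \<and> length p - 1 \<le> 0)"
    by (rule gdist_le_iff)
  also have "\<dots> \<longleftrightarrow> u = v"
  proof
    assume "\<exists>p. walk_betw G u p v \<and> length p - 1 \<le> 0"
    then obtain p where p: "walk_betw G u p v" "length p - 1 \<le> 0" by blast
    then obtain x where "p = [x]"
      by (cases p) (auto simp: walk_betw_def)
    with p show "u = v" by (simp add: walk_betw_singleton)
  next
    assume "u = v"
    then have "walk_betw G u [u] v" using assms by (simp add: walk_betw_singleton)
    then show "\<exists>p. walk_betw G u p v \<and> length p - 1 \<le> 0"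
      by (metis diff_self_eq_0 le_refl length_Cons list.size(3) One_nat_def)
  qed
  finally show ?thesis .
qed

lemma gdist_le_1_iff:
  assumes "u \<in> verts G" "v \<in> verts G"
  shows "gdist G u v \<le> 1 \<longleftrightarrow> u = v \<or> {u, v} \<in> edges G"
proof -
  have "gdist G u v \<le> 1 \<longleftrightarrow> (\<exists>p. walk_betw G u p v \<and> length p - 1 \<le> 1)"
    unfolding one_enat_def by (rule gdist_le_iff)
  also have "\<dots> \<longleftrightarrow> u = v \<or> {u, v} \<in> edges G"
  proof
    assume "\<exists>p. walk_betw G u p v \<and> length p - 1 \<le> 1"
    then obtain p where p: "walk_betw G u p v" "length p - 1 \<le> 1" by blast
    then have "p \<noteq> []" "length p \<le> 2" by (auto simp: walk_betw_def)
    then consider x where "p = [x]" | x y where "p = [x, y]"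
      by (auto simp: neq_Nil_conv le_Suc_eq length_Suc_conv numeral_2_eq_2)
    then show "u = v \<or> {u, v} \<in> edges G"
      using p by cases (auto simp: walk_betw_singleton walk_betw_pair)
  next
    assume "u = v \<or> {u, v} \<in> edges G"
    then have "walk_betw G u [u] v \<or> walk_betw G u [u, v] v"
      using assms by (auto simp: walk_betw_singleton walk_betw_pair)
    then show "\<exists>p. walk_betw G u p v \<and> length p - 1 \<le> 1"
      by (metis diff_Suc_1 le_SucI le_refl length_Cons list.size(3) One_nat_def)
  qed
  finally show ?thesis .
qed

lemma gdist_set_attained:
  assumes "C \<noteq> {}"
  shows "\<exists>w\<in>C. gdist G v w = gdist_set G v C"
proof -
  have "Inf (gdist G v ` C) \<in> gdist G v ` C"
    using assms by (metis (mono_tags) Inf_enat_def LeastI_ex ex_in_conv image_is_empty)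
  then show ?thesis
    by (auto simp: gdist_set_def)
qed

lemma gdist_set_le_1_iff:
  assumes "v \<in> verts G" "C \<subseteq> verts G" "C \<noteq> {}"
  shows "gdist_set G v C \<le> 1 \<longleftrightarrow> (\<exists>w\<in>C. v = w \<or> {v, w} \<in> edges G)"
proof
  assume "gdist_set G v C \<le> 1"
  then obtain w where "w \<in> C" "gdist G v w \<le> 1"
    using gdist_set_attained[OF assms(3), of G v] by auto
  then show "\<exists>w\<in>C. v = w \<or> {v, w} \<in> edges G"
    using gdist_le_1_iff assms by (metis subsetD)
next
  assume "\<exists>w\<in>C. v = w \<or> {v, w} \<in> edges G"
  then obtain w where "w \<in> C" "gdist G v w \<le> 1"
    using gdist_le_1_iff assms by (metis subsetD)
  then show "gdist_set G v C \<le> 1"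
    unfolding gdist_set_def by (meson INF_lower2)
qed

text \<open>The distance to \<open>C\<close> is 0 or 1. For \<open>v\<close> in \<open>C\<close>
  only \<open>v\<close> itself is nearest; otherwise every nearest vertex is a neighbour of
  \<open>v\<close>, so uniqueness reduces to uniqueness of a neighbour in \<open>C\<close>.\<close>

lemma unique_nearest_vertex:
  assumes "v \<in> verts G" "C \<subseteq> verts G" "C \<noteq> {}" "gdist_set G v C \<le> 1"
    and adj_unique: "\<And>w w'. v \<notin> C \<Longrightarrow> w \<in> C \<Longrightarrow> w' \<in> C \<Longrightarrow> {v, w} \<in> edges G \<Longrightarrow>
      {v, w'} \<in> edges G \<Longrightarrow> w = w'"
  shows "\<exists>!w. w \<in> C \<and> gdist G v w = gdist_set G v C"
proof -
  obtain w where w: "w \<in> C" "gdist G v w = gdist_set G v C"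
    using gdist_set_attained[OF assms(3)] by metis
  have "w' = w" if w': "w' \<in> C" "gdist G v w' = gdist_set G v C" for w'
  proof (cases "v \<in> C")
    case True
    have "gdist_set G v C \<le> gdist G v v"
      unfolding gdist_set_def using True by (rule INF_lower)
    also have "gdist G v v = 0"
      using gdist_eq_0_iff assms(1) by metis
    finally have "gdist_set G v C = 0"
      by simp
    then show ?thesis
      using w w' gdist_eq_0_iff[OF assms(1)] by metis
  next
    case False
    have "{v, u} \<in> edges G" if "u \<in> C" "gdist G v u = gdist_set G v C" for u
      using gdist_le_1_iff[of v G u] that assms False by auto
    then show ?thesis
      using adj_unique False w w' by blast
  qed
  with w show ?thesis
    by blast
qed

lemma walk_stays_in_closed_set:
  assumes "successively (\<lambda>x y. {x, y} \<in> E) p" "p \<noteq> []" "hd p \<in> B"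
    and "\<And>x y. x \<in> B \<Longrightarrow> {x, y} \<in> E \<Longrightarrow> y \<in> B"
  shows "set p \<subseteq> B"
  using assms(1-3)
proof (induction p)
  case (Cons x p)
  then show ?case
    using assms(4) by (cases p) auto
qed simp

text \<open>A walk in \<open>H\<close> from a vertex of \<open>B\<close> uses only edges of
  \<open>G\<close>, so it never leaves the closed set \<open>B\<close>.\<close>

lemma gconnected_subset_closed_set:
  assumes "gconnected H" "subgraph H G" "verts H \<inter> B \<noteq> {}"
    and closed: "\<And>x y. x \<in> B \<Longrightarrow> {x, y} \<in> edges G \<Longrightarrow> y \<in> B"
  shows "verts H \<subseteq> B"
proof
  fix y assume y: "y \<in> verts H"
  obtain x where x: "x \<in> verts H" "x \<in> B"
    using assms(3) by blast
  obtain p where p: "walk_betw H x p y"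
    using assms(1) x y by (auto simp: gconnected_def)
  have "set p \<subseteq> B"
  proof (rule walk_stays_in_closed_set)
    show "successively (\<lambda>x y. {x, y} \<in> edges H) p" "p \<noteq> []" "hd p \<in> B"
      using p x by (auto simp: walk_betw_def)
    show "v \<in> B" if "u \<in> B" "{u, v} \<in> edges H" for u v
      using that closed assms(2) by (auto simp: subgraph_def)
  qed
  then show "y \<in> B"
    using p by (auto simp: walk_betw_def)
qed

text \<open>By \<open>closed\<close>, no edge joins blocks of different index, so a connected
  subgraph that meets a block stays in it. As the blocks are connected, they are the maximal
  connected subgraphs.\<close>

lemma is_component_block_iff:
  fixes G :: "'a sgraph"
  assumes sub: "\<And>z. z \<in> L \<Longrightarrow> B z \<subseteq> verts G"
    and conn: "\<And>z. z \<in> L \<Longrightarrow> gconnected (induced_subgraph G (B z))"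
    and closed: "\<And>z z' x y. z \<in> L \<Longrightarrow> z' \<in> L \<Longrightarrow> x \<in> B z \<Longrightarrow> y \<in> B z' \<Longrightarrow>
      {x, y} \<in> edges G \<Longrightarrow> z = z'"
  shows "is_component (induced_subgraph G (\<Union>z\<in>L. B z)) C \<longleftrightarrow>
    (\<exists>z\<in>L. C = induced_subgraph G (B z))"
proof -
  let ?R = "\<Union>z\<in>L. B z"
  let ?G = "induced_subgraph G ?R"
  have absorb: "verts H \<subseteq> B z"
    if "z \<in> L" "gconnected H" "subgraph H ?G" "verts H \<inter> B z \<noteq> {}" for H z
  proof (rule gconnected_subset_closed_set[OF that(2,3,4)])
    fix x y assume "x \<in> B z" "{x, y} \<in> edges ?G"
    moreover from this obtain z' where "z' \<in> L" "y \<in> B z'"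
      by (auto simp: induced_subgraph_def)
    ultimately show "y \<in> B z"
      using closed[OF \<open>z \<in> L\<close>] by (auto simp: induced_subgraph_def)
  qed
  have block_sub: "subgraph (induced_subgraph G (B z)) ?G" if "z \<in> L" for z
    using that sub by (force simp: subgraph_def induced_subgraph_def)
  have sub_block: "subgraph H (induced_subgraph G (B z))"
    if "z \<in> L" "subgraph H ?G" "verts H \<subseteq> B z" for H z
    using that sub by (fastforce simp: subgraph_def induced_subgraph_def)
  have antisym: "H = H'" if "subgraph H H'" "subgraph H' H" for H H' :: "'a sgraph"
    using that by (auto simp: subgraph_def)
  show ?thesis
  proof
    assume C: "is_component ?G C"
    then obtain x where x: "x \<in> verts C"
      by (auto simp: is_component_def gconnected_def)
    with C obtain z where z: "z \<in> L" "x \<in> B z"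
      by (auto simp: is_component_def subgraph_def induced_subgraph_def)
    have "verts C \<subseteq> B z"
      using absorb z x C by (auto simp: is_component_def)
    then have "subgraph C (induced_subgraph G (B z))"
      using sub_block z C by (auto simp: is_component_def)
    \<comment> \<open>\<open>C\<close> lies in the connected subgraph induced by \<open>B z\<close>,
      so maximality of \<open>C\<close> forces equality.\<close>
    then show "\<exists>z\<in>L. C = induced_subgraph G (B z)"
      using C z block_sub conn unfolding is_component_def by metis
  next
    assume "\<exists>z\<in>L. C = induced_subgraph G (B z)"
    then obtain z where z: "z \<in> L" and C: "C = induced_subgraph G (B z)"
      by blast
    have "H = C" if H: "subgraph H ?G" "gconnected H" "subgraph C H" for H
    proof (rule antisym)
      have "verts C \<noteq> {}" "verts C \<subseteq> B z"
        using conn[OF z] C by (auto simp: gconnected_def induced_subgraph_def)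
      then have "verts H \<inter> B z \<noteq> {}"
        using H by (auto simp: subgraph_def)
      then show "subgraph H C"
        unfolding C using H z absorb sub_block by blast
    qed (rule H)
    then show "is_component ?G C"
      using z C block_sub conn by (auto simp: is_component_def)
  qed
qed

subsection \<open>The grid graph\<close>

definition grid_adj :: "int ^ 'n \<Rightarrow> int ^ 'n \<Rightarrow> bool" where
  "grid_adj u v \<longleftrightarrow> (\<exists>i s. (s = 1 \<or> s = -1) \<and> u = v + axis i s)"

text \<open>Integer squares sum to 1 only if one of them is 1 and the others vanish. This replaces
  Euclidean distance by steps along signed unit vectors.\<close>

lemma dist_real_vec_eq_1_iff:
  fixes u v :: "int ^ 'n::finite"
  shows "dist (real_vec u) (real_vec v) = 1 \<longleftrightarrow> grid_adj u v"
proof -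
  have "dist (real_vec u) (real_vec v) = sqrt (of_int (\<Sum>i\<in>UNIV. (u $ i - v $ i)\<^sup>2))"
    by (simp add: dist_vec_def L2_set_def real_vec_def dist_real_def)
  then have "dist (real_vec u) (real_vec v) = 1 \<longleftrightarrow> (\<Sum>i\<in>UNIV. (u $ i - v $ i)\<^sup>2) = 1"
    by (metis of_int_1 of_int_eq_iff real_sqrt_eq_1_iff)
  also have "\<dots> \<longleftrightarrow> grid_adj u v"
  proof
    assume sum: "(\<Sum>i\<in>UNIV. (u $ i - v $ i)\<^sup>2) = 1"
    then obtain i where i: "u $ i \<noteq> v $ i"
      by (metis (no_types, lifting) eq_iff_diff_eq_0 sum.neutral zero_neq_one zero_power2)
    have split: "(\<Sum>i\<in>UNIV. (u $ i - v $ i)\<^sup>2)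
        = (u $ i - v $ i)\<^sup>2 + (\<Sum>l\<in>UNIV - {i}. (u $ l - v $ l)\<^sup>2)"
      by (simp add: sum.remove)
    have nonneg: "(\<Sum>l\<in>UNIV - {i}. (u $ l - v $ l)\<^sup>2) \<ge> 0"
      by (simp add: sum_nonneg)
    have "(u $ i - v $ i)\<^sup>2 > 0"
      using i by simp
    then have eq: "(u $ i - v $ i)\<^sup>2 = 1" "(\<Sum>l\<in>UNIV - {i}. (u $ l - v $ l)\<^sup>2) = 0"
      using sum split nonneg by linarith+
    from eq(2) have "u $ l = v $ l" if "l \<noteq> i" for l
      using that by (subst (asm) sum_nonneg_eq_0_iff) auto
    then have "u = v + axis i (u $ i - v $ i)"
      by (auto simp: vec_eq_iff axis_def)
    moreover have "u $ i - v $ i = 1 \<or> u $ i - v $ i = -1"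
      using eq(1) by (simp add: power2_eq_1_iff)
    ultimately show "grid_adj u v"
      unfolding grid_adj_def by blast
  next
    assume "grid_adj u v"
    then obtain i s where s: "s = 1 \<or> s = -1" and u: "u = v + axis i s"
      by (auto simp: grid_adj_def)
    have "(u $ l - v $ l)\<^sup>2 = (if l = i then 1 else 0)" for l
      using s u by (auto simp: axis_def)
    then show "(\<Sum>i\<in>UNIV. (u $ i - v $ i)\<^sup>2) = 1"
      by simp
  qed
  finally show ?thesis .
qed

lemma axis_minus: "axis i (- s) = - (axis i s :: int ^ 'n)"
  by (simp add: vec_eq_iff axis_def)

lemma grid_adj_sym: "grid_adj u v \<longleftrightarrow> grid_adj v u"
proof -
  have "grid_adj v u" if "grid_adj u v" for u v :: "int ^ 'n"
  proof -
    from that obtain i s where s: "s = 1 \<or> s = -1" and u: "u = v + axis i s"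
      by (auto simp: grid_adj_def)
    have "v = u + axis i (- s)"
      unfolding axis_minus by (simp add: u)
    then show ?thesis
      unfolding grid_adj_def using s by (metis minus_minus)
  qed
  then show ?thesis
    by blast
qed

lemma grid_adj_add_right [simp]: "grid_adj (u + z) (v + z) \<longleftrightarrow> grid_adj u v"
proof -
  have "u + z = v + z + axis i s \<longleftrightarrow> u = v + axis i s" for i s
    by (subst add.assoc, subst add.commute[of z], subst add.assoc[symmetric]) (rule add_right_cancel)
  then show ?thesis
    by (simp add: grid_adj_def)
qed

lemma verts_Lambda [simp]: "verts \<Lambda> = UNIV"
  by (simp add: Lambda_def)

lemma edges_Lambda_iff: "{u, v} \<in> edges \<Lambda> \<longleftrightarrow> grid_adj u v"
  using grid_adj_sym[of u v] by (auto simp: Lambda_def dist_real_vec_eq_1_iff doubleton_eq_iff)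

lemma edges_LambdaE:
  assumes "e \<in> edges \<Lambda>"
  obtains u v where "e = {u, v}" "grid_adj u v"
  using assms by (auto simp: Lambda_def dist_real_vec_eq_1_iff)

text \<open>Translations preserve \<open>grid_adj\<close>, so they are automorphisms of the grid.
  Thus \<open>lattice_like\<close>, which speaks of translated graphs, can be checked on translated
  vertex sets.\<close>

lemma translate_induced_Lambda:
  "translate (induced_subgraph \<Lambda> S) z = induced_subgraph \<Lambda> ((\<lambda>x. x + z) ` S)"
proof -
  have "(\<lambda>e. (\<lambda>x. x + z) ` e) ` {e \<in> edges \<Lambda>. e \<subseteq> S} = {e \<in> edges \<Lambda>. e \<subseteq> (\<lambda>x. x + z) ` S}"
    (is "?l = ?r")
  proof (intro equalityI subsetI)
    fix e assume "e \<in> ?l"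
    then obtain d where d: "d \<in> edges \<Lambda>" "d \<subseteq> S" "e = (\<lambda>x. x + z) ` d"
      by blast
    from d(1) obtain u v where "d = {u, v}" "grid_adj u v"
      by (rule edges_LambdaE)
    with d show "e \<in> ?r"
      by (auto simp: edges_Lambda_iff)
  next
    fix e assume e: "e \<in> ?r"
    then obtain u v where uv: "e = {u, v}" "grid_adj u v"
      by (metis (no_types, lifting) edges_LambdaE mem_Collect_eq)
    with e obtain u' v' where "u = u' + z" "v = v' + z" "u' \<in> S" "v' \<in> S"
      by auto
    with uv show "e \<in> ?l"
      by (intro image_eqI[of _ _ "{u', v'}"]) (auto simp: edges_Lambda_iff)
  qed
  then show ?thesis
    by (simp add: translate_def induced_subgraph_def)
qed

subsection \<open>Tiling the grid by neighbourhoods of a unit square\<close>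

text \<open>The pair \<open>(c i, j i)\<close> is the \<open>\<int>/3 \<times> \<int>/(2 k + 1)\<close> part of the image of the unit vector \<open>i\<close>.\<close>

locale square_tiling =
  fixes i1 i2 :: "'n::finite" and c j :: "'n \<Rightarrow> int" and k :: nat
  assumes i12: "i1 \<noteq> i2"
    and c_i1: "c i1 = 0" and c_i2: "c i2 = 1" and j_i1: "j i1 = 0" and j_i2: "j i2 = 0"
    and labels: "bij_betw (\<lambda>i. (c i, j i)) (UNIV - {i1, i2}) ({0..2} \<times> {1..int k})"
begin

section \<open>The homomorphism and its kernel\<close>

definition corner :: "int \<Rightarrow> int \<Rightarrow> int ^ 'n" where
  "corner p r = axis i1 p + axis i2 r"

definition Q :: "(int ^ 'n) set" where
  "Q = {corner p r | p r. p \<in> {0, 1} \<and> r \<in> {0, 1}}"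

definition tile :: "(int ^ 'n) set" where
  "tile = {x. \<exists>q\<in>Q. x = q \<or> grid_adj x q}"

text \<open>Together with \<open>g\<close> and \<open>h\<close>, an integer lift of the
  homomorphism. On the four vertices of the square, \<open>f\<close> takes each of the values 0, 1,
  2, 3 once.\<close>

definition f :: "int ^ 'n \<Rightarrow> int" where
  "f x = x $ i1 + 2 * x $ i2"

definition g :: "int ^ 'n \<Rightarrow> int" where
  "g x = (\<Sum>i\<in>UNIV. c i * x $ i)"

definition h :: "int ^ 'n \<Rightarrow> int" where
  "h x = (\<Sum>i\<in>UNIV. j i * x $ i)"

text \<open>The kernel of the homomorphism: two vertices differ by an element of \<open>L\<close>
  iff they have the same image.\<close>

definition L :: "(int ^ 'n) set" where
  "L = {x. 4 dvd f x \<and> 3 dvd g x \<and> (2 * int k + 1) dvd h x}"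

lemma fgh_add: "f (x + y) = f x + f y" "g (x + y) = g x + g y" "h (x + y) = h x + h y"
  by (simp_all add: f_def g_def h_def algebra_simps sum.distrib)

lemma fgh_minus: "f (- x) = - f x" "g (- x) = - g x" "h (- x) = - h x"
  by (simp_all add: f_def g_def h_def sum_negf)

lemma fgh_diff: "f (x - y) = f x - f y" "g (x - y) = g x - g y" "h (x - y) = h x - h y"
  by (simp_all add: f_def g_def h_def algebra_simps sum_subtractf)

lemma g_axis: "g (axis i s) = c i * s" and h_axis: "h (axis i s) = j i * s"
  by (simp_all add: g_def h_def axis_def if_distrib[of "\<lambda>x. _ * x"] cong: if_cong)

lemma corner_nth [simp]:
  "corner p r $ i1 = p" "corner p r $ i2 = r" "i \<noteq> i1 \<Longrightarrow> i \<noteq> i2 \<Longrightarrow> corner p r $ i = 0"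
  using i12 by (auto simp: corner_def axis_def)

lemma fgh_corner: "f (corner p r) = p + 2 * r" "g (corner p r) = r" "h (corner p r) = 0"
  by (simp_all add: f_def, simp_all add: corner_def fgh_add g_axis h_axis c_i1 c_i2 j_i1 j_i2)

lemma f_axis: "i \<noteq> i1 \<Longrightarrow> i \<noteq> i2 \<Longrightarrow> f (axis i s) = 0"
  by (simp add: f_def axis_def)

lemma lattice_L: "is_lattice L"
  by (auto simp: is_lattice_def L_def fgh_add fgh_minus) (simp_all add: f_def g_def h_def)

lemma corner_eq_iff [simp]: "corner p r = corner p' r' \<longleftrightarrow> p = p' \<and> r = r'"
  by (metis corner_nth(1,2))

text \<open>A step within the plane leads to another \<open>corner\<close>, possibly with an
  argument -1 or 2 when it starts on the square; hence \<open>corner\<close> takes arbitrary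
  integers.\<close>

lemma corner_add_axis:
  "corner p r + axis i1 s = corner (p + s) r" "corner p r + axis i2 s = corner p (r + s)"
  using i12 by (auto simp: corner_def vec_eq_iff axis_def)

section \<open>Injectivity of the homomorphism on the closed neighbourhood\<close>

definition in_plane :: "int \<Rightarrow> int \<Rightarrow> bool" where
  "in_plane p r \<longleftrightarrow> (p \<in> {0, 1} \<and> r \<in> {-1, 0, 1, 2}) \<or> (p \<in> {-1, 0, 1, 2} \<and> r \<in> {0, 1})"

lemma in_plane_bounds:
  assumes "in_plane p r"
  shows "-1 \<le> p" "p \<le> 2" "-1 \<le> r" "r \<le> 2" "r = -1 \<or> r = 2 \<Longrightarrow> 0 \<le> p \<and> p \<le> 1"
  using assms by (auto simp: in_plane_def)

text \<open>The cross \<open>in_plane\<close> consists of the square and its eight neighbours in the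
  plane. Within a row, \<open>p\<close> takes at most four consecutive values, which residues modulo
  4 separate. Modulo 3 only the rows -1 and 2 coincide; there \<open>p\<close> is 0 or 1, too narrow
  a range to make up for the change of \<open>2 * r\<close> by 6, which is 2 modulo 4.\<close>

lemma in_plane_inj:
  assumes "in_plane p r" "in_plane p' r'"
    and dvd: "4 dvd (p + 2 * r) - (p' + 2 * r')" "3 dvd r - r'"
  shows "p = p' \<and> r = r'"
proof -
  have bounds: "-1 \<le> p" "p \<le> 2" "-1 \<le> r" "r \<le> 2" "-1 \<le> p'" "p' \<le> 2" "-1 \<le> r'" "r' \<le> 2"
    and arms: "r = -1 \<or> r = 2 \<Longrightarrow> 0 \<le> p \<and> p \<le> 1" "r' = -1 \<or> r' = 2 \<Longrightarrow> 0 \<le> p' \<and> p' \<le> 1"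
    using in_plane_bounds[OF assms(1)] in_plane_bounds[OF assms(2)] by blast+
  obtain a where a: "(p + 2 * r) - (p' + 2 * r') = 4 * a"
    using dvd(1) by (rule dvdE)
  obtain b where b: "r - r' = 3 * b"
    using dvd(2) by (rule dvdE)
  have "b = -1 \<or> b = 0 \<or> b = 1"
    using b bounds by linarith
  then consider "b = 0" | "r = -1" "r' = 2" | "r = 2" "r' = -1"
    using b bounds by linarith
  then show ?thesis
  proof cases
    case 1
    with a b have "p - p' = 4 * a"
      by simp
    then have "a = 0"
      using bounds by linarith
    with a b 1 show ?thesis
      by simp
  next
    case 2
    then have "p - p' - 6 = 4 * a" "\<bar>p - p'\<bar> \<le> 1"
      using a arms by auto
    then show ?thesis
      by presburger
  next
    case 3
    then have "p - p' + 6 = 4 * a" "\<bar>p - p'\<bar> \<le> 1"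
      using a arms by auto
    then show ?thesis
      by presburger
  qed
qed

text \<open>The split follows the third component of the image: \<open>h\<close> vanishes in the
  plane, and by \<open>out_of_plane_h\<close> it is nonzero modulo \<open>2 * k + 1\<close>
  outside.\<close>

lemma tile_cases:
  assumes "x \<in> tile"
  obtains p r where "in_plane p r" "x = corner p r"
  | p r s i where "p \<in> {0, 1}" "r \<in> {0, 1}" "s \<in> {1, -1}" "i \<noteq> i1" "i \<noteq> i2"
      "x = corner p r + axis i s"
proof -
  from assms obtain p r where q: "p \<in> {0, 1}" "r \<in> {0, 1}"
    and x: "x = corner p r \<or> grid_adj x (corner p r)"
    by (auto simp: tile_def Q_def)
  from x show ?thesis
  proof
    assume "x = corner p r"
    with q that(1)[of p r] show ?thesis
      by (auto simp: in_plane_def)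
  next
    assume "grid_adj x (corner p r)"
    then obtain i s where s: "s \<in> {1, -1}" and x: "x = corner p r + axis i s"
      by (auto simp: grid_adj_def)
    consider "i = i1" | "i = i2" | "i \<noteq> i1" "i \<noteq> i2"
      by blast
    then show ?thesis
    proof cases
      case 1
      with q s x that(1)[of "p + s" r] show ?thesis
        by (auto simp: in_plane_def corner_add_axis)
    next
      case 2
      with q s x that(1)[of p "r + s"] show ?thesis
        by (auto simp: in_plane_def corner_add_axis)
    next
      case 3
      with q s x that(2) show ?thesis
        by blast
    qed
  qed
qed

lemma out_of_plane_in_tile:
  assumes "p \<in> {0, 1}" "r \<in> {0, 1}" "s \<in> {1, -1}"
  shows "corner p r + axis i s \<in> tile"
  using assms unfolding tile_def Q_def grid_adj_def by blast

lemma in_plane_in_tile: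
  assumes "in_plane p r"
  shows "corner p r \<in> tile"
proof (cases "p \<in> {0, 1} \<and> r \<in> {0, 1}")
  case True
  then show ?thesis
    by (auto simp: tile_def Q_def)
next
  case False
  with assms consider "p = -1" "r \<in> {0, 1}" | "p = 2" "r \<in> {0, 1}"
    | "r = -1" "p \<in> {0, 1}" | "r = 2" "p \<in> {0, 1}"
    by (auto simp: in_plane_def)
  then show ?thesis
    using out_of_plane_in_tile[of 0 r "-1" i1] out_of_plane_in_tile[of 1 r 1 i1]
      out_of_plane_in_tile[of p 0 "-1" i2] out_of_plane_in_tile[of p 1 1 i2]
    by cases (simp_all add: corner_add_axis)
qed

lemma label_range:
  assumes "i \<noteq> i1" "i \<noteq> i2"
  shows "c i \<in> {0..2}" "j i \<in> {1..int k}"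
  using bij_betwE[OF labels] assms by auto

text \<open>The value is \<open>j i * s\<close>, of absolute value between 1 and \<open>k\<close>,
  hence too small for a multiple of the modulus.\<close>

lemma out_of_plane_h:
  assumes "i \<noteq> i1" "i \<noteq> i2" "s \<in> {1, -1}"
  shows "\<not> (2 * int k + 1) dvd h (corner p r + axis i s)"
proof
  assume "(2 * int k + 1) dvd h (corner p r + axis i s)"
  then have "(2 * int k + 1) dvd j i"
    using assms by (auto simp: fgh_add fgh_corner h_axis)
  then show False
    using label_range(2)[OF assms(1,2)] by (auto dest!: zdvd_imp_le)
qed

text \<open>A point is decoded from its image. \<open>h\<close> tells whether it lies in the plane,
  where \<open>in_plane_inj\<close> applies. Outside, \<open>h\<close> yields \<open>s\<close> and
  \<open>j i\<close>, \<open>f\<close> yields the corner, \<open>g\<close> then yields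
  \<open>c i\<close>, and the label determines \<open>i\<close>.\<close>

lemma tile_inj:
  assumes "x \<in> tile" "y \<in> tile" "x - y \<in> L"
  shows "x = y"
  using assms(1)
proof (cases rule: tile_cases)
  case (1 p r)
  note x = this
  show ?thesis
    using assms(2)
  proof (cases rule: tile_cases)
    case (1 p' r')
    have "4 dvd (p + 2 * r) - (p' + 2 * r')" "3 dvd r - r'"
      using assms(3) x 1 by (auto simp: L_def fgh_diff fgh_corner)
    then have "p = p' \<and> r = r'"
      by (rule in_plane_inj[OF x(1) 1(1)])
    then show ?thesis
      using x 1 by simp
  next
    case (2 p' r' s i)
    then have "(2 * int k + 1) dvd h y"
      using assms(3) x by (simp add: L_def fgh_diff fgh_corner)
    then show ?thesis
      using 2 out_of_plane_h by auto
  qed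
next
  case (2 p r s i)
  note x = this
  show ?thesis
    using assms(2)
  proof (cases rule: tile_cases)
    case (1 p' r')
    then have "(2 * int k + 1) dvd h x"
      using assms(3) by (simp add: L_def fgh_diff fgh_corner)
    then show ?thesis
      using x out_of_plane_h by auto
  next
    case (2 p' r' s' i')
    have dvd: "4 dvd (p + 2 * r) - (p' + 2 * r')" "3 dvd r + c i * s - (r' + c i' * s')"
      "(2 * int k + 1) dvd j i * s - j i' * s'"
      using assms(3) x 2
      by (auto simp: L_def fgh_diff fgh_add fgh_corner f_axis g_axis h_axis)
    \<comment> \<open>\<open>p\<close> and \<open>r\<close> are the binary digits of
      \<open>p + 2 * r\<close>, a number from 0 to 3.\<close>
    have pr: "p = p'" "r = r'"
      using dvd(1) x(1,2) 2(1,2) by auto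
    note rng = label_range[OF x(4,5)] label_range[OF 2(4,5)]
    \<comment> \<open>Each product has absolute value at most \<open>k\<close>.\<close>
    have small: "\<bar>j i * s - j i' * s'\<bar> < 2 * int k + 1"
      using rng x(3) 2(3) by auto
    have "j i * s = j i' * s'"
      using dvd_imp_le_int[OF _ dvd(3)] small by fastforce
    then have s: "s = s'" and j: "j i = j i'"
      using rng x(3) 2(3) by auto
    have "3 dvd c i - c i'"
      using dvd(2) pr s x(3) by (auto simp: dvd_diff_commute)
    moreover have "c i \<in> {0, 1, 2}" "c i' \<in> {0, 1, 2}"
      using rng by auto
    ultimately have "c i = c i'"
      by auto
    then have "i = i'"
      using inj_onD[OF bij_betw_imp_inj_on[OF labels], of i i'] j x(4,5) 2(4,5) by simp
    then show ?thesis
      using pr s x 2 by simp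
  qed
qed

section \<open>Surjectivity of the homomorphism on the closed neighbourhood\<close>

lemma tile_surj: "\<exists>z\<in>L. v - z \<in> tile"
proof -
  have "\<exists>x\<in>tile. v - x \<in> L"
  proof (cases "(2 * int k + 1) dvd h v")
    case True
    have "\<exists>p r. in_plane p r \<and> 4 dvd f v - (p + 2 * r) \<and> 3 dvd g v - r"
    proof -
      \<comment> \<open>The rows 0 and 1 have four consecutive values of \<open>p\<close>, enough
        for all residues of \<open>f\<close> modulo 4; residue 2 of \<open>g\<close> needs the two
        short rows of the cross together.\<close>
      consider r where "r = 0 \<or> r = 1" "3 dvd g v - r" | "3 dvd g v - 2"
      proof -
        have "3 dvd g v - 0 \<or> 3 dvd g v - 1 \<or> 3 dvd g v - 2"
          by presburger
        with that show ?thesis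
          by blast
      qed
      then show ?thesis
      proof cases
        case (1 r)
        have "4 dvd f v - (-1 + 2 * r) \<or> 4 dvd f v - (0 + 2 * r) \<or>
            4 dvd f v - (1 + 2 * r) \<or> 4 dvd f v - (2 + 2 * r)"
          by presburger
        then obtain p where "p = -1 \<or> p = 0 \<or> p = 1 \<or> p = 2" "4 dvd f v - (p + 2 * r)"
          by blast
        with 1 show ?thesis
          unfolding in_plane_def by blast
      next
        case 2
        then have "3 dvd g v - (-1)"
          by presburger
        \<comment> \<open>Residue 2 modulo 3 belongs to \<open>r = 2\<close> and to
          \<open>r = -1\<close>. For \<open>p\<close> in {0, 1}, \<open>p + 4\<close> gives the
          residues 0, 1 and \<open>p - 2\<close> the residues 2, 3 modulo 4.\<close>
        moreover have "4 dvd f v - (0 + 2 * 2) \<or> 4 dvd f v - (1 + 2 * 2) \<or>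
            4 dvd f v - (0 + 2 * (-1)) \<or> 4 dvd f v - (1 + 2 * (-1))"
          by presburger
        ultimately show ?thesis
          using 2 unfolding in_plane_def by blast
      qed
    qed
    then obtain p r where "in_plane p r" "4 dvd f v - (p + 2 * r)" "3 dvd g v - r"
      by blast
    then have "corner p r \<in> tile" "v - corner p r \<in> L"
      using True by (auto simp: in_plane_in_tile L_def fgh_diff fgh_corner)
    then show ?thesis
      by blast
  next
    case False
    define m where "m = 2 * int k + 1"
    define t where "t = h v mod m"
    have m: "m > 0"
      by (simp add: m_def)
    have t: "t \<noteq> 0" "0 \<le> t" "t < m" "m dvd h v - t"
      using False m unfolding t_def m_def[symmetric]
      by (simp_all add: dvd_eq_mod_eq_0 minus_mod_eq_mult_div)
    \<comment> \<open>The symmetric representative of the residue: \<open>t\<close> if it is at most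
      \<open>k\<close>, otherwise \<open>-(m - t)\<close>.\<close>
    obtain s b where s: "s \<in> {1, -1 :: int}" and b: "b \<in> {1..int k}" and hb: "m dvd h v - b * s"
    proof (cases "t \<le> int k")
      case True
      with t that[of 1 t] show ?thesis
        by auto
    next
      case False
      have "h v - (m - t) * (-1) = (h v - t) + m"
        by simp
      then have "m dvd h v - (m - t) * (-1)"
        using t(4) by (metis dvd_add dvd_refl)
      with False t that[of "-1" "m - t"] show ?thesis
        by (auto simp: m_def)
    qed
    obtain p r where pr: "p \<in> {0, 1 :: int}" "r \<in> {0, 1 :: int}" "4 dvd f v - (p + 2 * r)"
    proof -
      have "\<exists>p\<in>{0, 1}. \<exists>r\<in>{0, 1}. 4 dvd f v - (p + 2 * r)"
        by simp presburger
      with that show ?thesis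
        by blast
    qed
    \<comment> \<open>The corner is already fixed by \<open>f\<close>, to which a step out of the
      plane contributes nothing. The label \<open>a\<close> corrects what remains of
      \<open>g\<close>; its formula uses \<open>s * s = 1\<close>.\<close>
    obtain a where a: "a \<in> {0..2}" "3 dvd g v - (r + a * s)"
    proof
      show "(g v - r) * s mod 3 \<in> {0..2}"
        by auto
      show "3 dvd g v - (r + ((g v - r) * s mod 3) * s)"
        using s by auto presburger+
    qed
    have "(a, b) \<in> (\<lambda>i. (c i, j i)) ` (UNIV - {i1, i2})"
      using labels a b by (simp add: bij_betw_def)
    then obtain i where i: "i \<noteq> i1" "i \<noteq> i2" "c i = a" "j i = b"
      by auto
    have "v - (corner p r + axis i s) \<in> L"
      using pr a hb i by (simp add: L_def fgh_diff fgh_add fgh_corner f_axis g_axis h_axis m_def)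
    then show ?thesis
      using out_of_plane_in_tile pr s by blast
  qed
  then obtain x where "x \<in> tile" "v - x \<in> L"
    by blast
  then show ?thesis
    by (intro bexI[of _ "v - x"]) auto
qed

section \<open>Translates of the square and the vertices near them\<close>

definition block :: "int ^ 'n \<Rightarrow> (int ^ 'n) set" where
  "block z = (\<lambda>x. x + z) ` Q"

text \<open>Translation invariance turns existence and uniqueness of a block near \<open>v\<close>
  into \<open>tile_surj\<close> and \<open>tile_inj\<close>.\<close>

lemma block_near_iff: "(\<exists>w\<in>block z. v = w \<or> grid_adj v w) \<longleftrightarrow> v - z \<in> tile"
proof -
  have "v = q + z \<or> grid_adj v (q + z) \<longleftrightarrow> v - z = q \<or> grid_adj (v - z) q" for q
    using grid_adj_add_right[of "v - z" z q] by (auto simp: algebra_simps)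
  then show ?thesis
    by (simp add: block_def tile_def)
qed

lemma block_near_unique:
  assumes "z \<in> L" "z' \<in> L" "v - z \<in> tile" "v - z' \<in> tile"
  shows "z = z'"
proof -
  have "(v - z) - (v - z') = z' + (- z)"
    by simp
  then have "(v - z) - (v - z') \<in> L"
    using lattice_L assms(1,2) by (metis is_lattice_def)
  then have "v - z = v - z'"
    using tile_inj assms by blast
  then show ?thesis
    by simp
qed

lemma Q_nearest_unique:
  assumes "x \<notin> Q" "q \<in> Q" "q' \<in> Q" "grid_adj x q" "grid_adj x q'"
  shows "q = q'"
proof -
  \<comment> \<open>The nearest vertex of \<open>Q\<close> is the coordinatewise projection onto the square.\<close>
  define clamp :: "int \<Rightarrow> int" where "clamp a = max 0 (min 1 a)" for a
  have "q = corner (clamp (x $ i1)) (clamp (x $ i2))" if q: "q \<in> Q" "grid_adj x q" for q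
  proof -
    from q obtain p r where pr: "p \<in> {0, 1}" "r \<in> {0, 1}" "q = corner p r"
      by (auto simp: Q_def)
    with q obtain i s where s: "s = 1 \<or> s = -1" and x: "x = corner p r + axis i s"
      by (auto simp: grid_adj_def)
    consider "i = i1" | "i = i2" | "i \<noteq> i1" "i \<noteq> i2"
      by blast
    then show ?thesis
    proof cases
      case 1
      then have x: "x = corner (p + s) r"
        using x by (simp add: corner_add_axis)
      \<comment> \<open>Outside the square the first coordinate is -1 or 2, and clamping returns it
        to \<open>p\<close>.\<close>
      then have "p + s \<notin> {0, 1}"
        using assms(1) pr by (auto simp: Q_def)
      then show ?thesis
        using x pr s by (auto simp: clamp_def)
    next
      case 2
      then have x: "x = corner p (r + s)"
        using x by (simp add: corner_add_axis)
      then have "r + s \<notin> {0, 1}"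
        using assms(1) pr by (auto simp: Q_def)
      then show ?thesis
        using x pr s by (auto simp: clamp_def)
    next
      case 3
      then have "x $ i1 = p" "x $ i2 = r"
        using x by (auto simp: axis_def)
      then show ?thesis
        using pr by (auto simp: clamp_def)
    qed
  qed
  then show ?thesis
    using assms by metis
qed

lemma block_nearest_unique:
  assumes "v \<notin> block z" "w \<in> block z" "w' \<in> block z" "grid_adj v w" "grid_adj v w'"
  shows "w = w'"
proof -
  from assms obtain q q' where q: "q \<in> Q" "q' \<in> Q" "w = q + z" "w' = q' + z"
    by (auto simp: block_def)
  have "v - z \<notin> Q"
  proof
    assume "v - z \<in> Q"
    then have "(v - z) + z \<in> block z"
      unfolding block_def by blast
    with assms(1) show False
      by simp
  qed
  moreover have "grid_adj (v - z) q" "grid_adj (v - z) q'"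
    using assms q grid_adj_add_right[of "v - z" z] by auto
  ultimately show ?thesis
    using Q_nearest_unique q by blast
qed

section \<open>The graph induced on a translate of the square\<close>

lemma block_eq: "block z = {corner p r + z | p r. p \<in> {0, 1} \<and> r \<in> {0, 1}}"
  by (auto simp: block_def Q_def)

text \<open>The right-hand side says that exactly one coordinate differs; the same criterion
  describes adjacency in the product of two paths on two vertices.\<close>

lemma grid_adj_corner_iff:
  assumes "p \<in> {0, 1}" "r \<in> {0, 1}" "p' \<in> {0, 1}" "r' \<in> {0, 1}"
  shows "grid_adj (corner p r) (corner p' r') \<longleftrightarrow> (p = p' \<longleftrightarrow> r \<noteq> r')"
proof
  assume "grid_adj (corner p r) (corner p' r')"
  then obtain i s where s: "s = 1 \<or> s = -1" and eq: "corner p r = corner p' r' + axis i s"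
    by (auto simp: grid_adj_def)
  \<comment> \<open>The third equation rules out a direction \<open>i\<close> outside the plane,
    where both corners have coordinate 0.\<close>
  have "p = p' + axis i s $ i1" "r = r' + axis i s $ i2" "corner p r $ i = corner p' r' $ i + s"
    using arg_cong[OF eq, of "\<lambda>x. x $ i1"] arg_cong[OF eq, of "\<lambda>x. x $ i2"]
      arg_cong[OF eq, of "\<lambda>x. x $ i"]
    by (simp_all add: axis_def)
  then show "p = p' \<longleftrightarrow> r \<noteq> r'"
    using s i12 by (cases "i = i1"; cases "i = i2") (auto simp: axis_def)
next
  assume *: "p = p' \<longleftrightarrow> r \<noteq> r'"
  show "grid_adj (corner p r) (corner p' r')"
  proof (cases "p = p'")
    case True
    then have "corner p r = corner p' r' + axis i2 (r - r')" "r - r' = 1 \<or> r - r' = -1"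
      using * assms by (auto simp: corner_add_axis)
    then show ?thesis
      unfolding grid_adj_def by blast
  next
    case False
    then have "corner p r = corner p' r' + axis i1 (p - p')" "p - p' = 1 \<or> p - p' = -1"
      using * assms by (auto simp: corner_add_axis)
    then show ?thesis
      unfolding grid_adj_def by blast
  qed
qed

lemma gconnected_block: "gconnected (induced_subgraph \<Lambda> (block z))"
proof -
  let ?G = "induced_subgraph \<Lambda> (block z)"
  have edge: "{corner p r + z, corner p' r' + z} \<in> edges ?G \<longleftrightarrow> (p = p' \<longleftrightarrow> r \<noteq> r')"
    if "p \<in> {0, 1}" "r \<in> {0, 1}" "p' \<in> {0, 1}" "r' \<in> {0, 1}" for p r p' r'
    using that grid_adj_corner_iff[OF that]
    by (auto simp: induced_subgraph_def edges_Lambda_iff block_eq)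
  have verts: "verts ?G = block z"
    by (simp add: induced_subgraph_def)
  have "\<exists>l. walk_betw ?G u l v" if "u \<in> block z" "v \<in> block z" for u v
  proof -
    from that obtain p r p' r' where pr: "p \<in> {0, 1}" "r \<in> {0, 1}" "p' \<in> {0, 1}" "r' \<in> {0, 1}"
      and u: "u = corner p r + z" and v: "v = corner p' r' + z"
      unfolding block_eq by blast
    \<comment> \<open>The turning point of the walk when \<open>u\<close> and \<open>v\<close> are
      diagonally opposite.\<close>
    have mid: "corner p r' + z \<in> block z"
      using pr unfolding block_eq by blast
    consider "p = p'" "r = r'" | "p = p' \<longleftrightarrow> r \<noteq> r'" | "p \<noteq> p'" "r \<noteq> r'"
      by blast
    then show ?thesis
    proof cases
      case 1
      then have "walk_betw ?G u [u] v"
        using that u v by (simp add: walk_betw_singleton verts)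
      then show ?thesis ..
    next
      case 2
      then have "walk_betw ?G u [u, v] v"
        using that edge[OF pr] by (simp add: walk_betw_pair verts u v)
      then show ?thesis ..
    next
      case 3
      then have "walk_betw ?G u [u, corner p r' + z, v] v"
        using that mid edge[of p r p r'] edge[of p r' p' r'] pr
        by (simp add: walk_betw_def verts u v)
      then show ?thesis ..
    qed
  qed
  moreover have "corner 0 0 + z \<in> block z"
    unfolding block_eq by blast
  ultimately show ?thesis
    unfolding gconnected_def verts by blast
qed

lemma graph_iso_block: "graph_iso (induced_subgraph \<Lambda> (block z)) (path_graph 2 \<box> path_graph 2)"
proof -
  let ?G = "induced_subgraph \<Lambda> (block z)"
  let ?H = "path_graph 2 \<box> path_graph 2"
  \<comment> \<open>Coordinates relative to \<open>z\<close>, converted by \<open>nat\<close>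
    because the vertices of \<open>path_graph\<close> are natural numbers.\<close>
  define F where "F x = (nat ((x - z) $ i1), nat ((x - z) $ i2))" for x
  have F: "F (corner p r + z) = (nat p, nat r)" for p r
    by (simp add: F_def)
  have P2: "verts (path_graph 2) = {0, 1}" "edges (path_graph 2) = {{0, 1}}"
    by (auto simp: path_graph_def)
  have verts_H: "verts ?H = {0, 1} \<times> {0, 1}"
    by (simp add: cartesian_product_def P2)
  have edges_H: "{(a, b), (a', b')} \<in> edges ?H \<longleftrightarrow> (a = a' \<longleftrightarrow> b \<noteq> b')"
    if "a \<in> {0, 1}" "b \<in> {0, 1}" "a' \<in> {0, 1}" "b' \<in> {0, 1}" for a b a' b' :: nat
    using that by (auto simp: cartesian_product_def P2 doubleton_eq_iff)
  have verts: "verts ?G = block z"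
    by (simp add: induced_subgraph_def)
  have "bij_betw F (block z) ({0, 1} \<times> {0, 1})"
  proof (rule bij_betw_imageI)
    show "inj_on F (block z)"
      by (auto simp: inj_on_def block_eq F)
    have "block z = {corner 0 0 + z, corner 0 1 + z, corner 1 0 + z, corner 1 1 + z}"
      by (auto simp: block_eq)
    then show "F ` block z = {0, 1} \<times> {0, 1}"
      by (auto simp: F)
  qed
  moreover have "{u, v} \<in> edges ?G \<longleftrightarrow> {F u, F v} \<in> edges ?H"
    if uv: "u \<in> block z" "v \<in> block z" for u v
  proof -
    from uv obtain p r p' r' where pr: "p \<in> {0, 1}" "r \<in> {0, 1}" "p' \<in> {0, 1}" "r' \<in> {0, 1}"
      and u: "u = corner p r + z" and v: "v = corner p' r' + z"
      unfolding block_eq by blast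
    have "{u, v} \<in> edges ?G \<longleftrightarrow> (p = p' \<longleftrightarrow> r \<noteq> r')"
      using uv grid_adj_corner_iff[OF pr] by (simp add: induced_subgraph_def edges_Lambda_iff u v)
    also have "\<dots> \<longleftrightarrow> (nat p = nat p' \<longleftrightarrow> nat r \<noteq> nat r')"
    proof -
      have "p \<ge> 0" "r \<ge> 0" "p' \<ge> 0" "r' \<ge> 0"
        using pr by auto
      then show ?thesis
        by (simp add: eq_nat_nat_iff)
    qed
    also have "\<dots> \<longleftrightarrow> {F u, F v} \<in> edges ?H"
      unfolding u v F by (rule edges_H[symmetric]) (use pr in auto)
    finally show ?thesis .
  qed
  ultimately show ?thesis
    unfolding graph_iso_def verts verts_H by blast
qed

section \<open>The union of the translates by lattice vectors\<close>

definition R :: "(int ^ 'n) set" where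
  "R = (\<Union>z\<in>L. block z)"

lemma is_component_R_iff:
  "is_component (induced_subgraph \<Lambda> R) C \<longleftrightarrow> (\<exists>z\<in>L. C = induced_subgraph \<Lambda> (block z))"
  unfolding R_def
proof (rule is_component_block_iff)
  fix z z' x y
  assume z: "z \<in> L" "z' \<in> L" and xy: "x \<in> block z" "y \<in> block z'" "{x, y} \<in> edges \<Lambda>"
  \<comment> \<open>\<open>x\<close> belongs to one block and is adjacent to a vertex of the other,
    so it is near both.\<close>
  then have "x - z \<in> tile" "x - z' \<in> tile"
    using block_near_iff by (auto simp: edges_Lambda_iff)
  then show "z = z'"
    using block_near_unique z by blast
qed (auto simp: gconnected_block)

lemma gdist_set_block_le_iff: "gdist_set \<Lambda> v (block z) \<le> 1 \<longleftrightarrow> v - z \<in> tile"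
proof -
  have "block z \<noteq> {}"
    using gconnected_block[of z] by (auto simp: gconnected_def induced_subgraph_def)
  then show ?thesis
    by (simp add: gdist_set_le_1_iff edges_Lambda_iff block_near_iff)
qed

text \<open>\<open>tile_surj\<close> provides a component near \<open>v\<close>,
  \<open>block_near_unique\<close> shows that it is the only one, and
  \<open>block_nearest_unique\<close> gives the unique nearest vertex in it.\<close>

lemma PDDS_R: "PDDS 1 \<Lambda> R"
proof -
  have verts: "verts (induced_subgraph \<Lambda> (block z)) = block z" for z
    by (simp add: induced_subgraph_def)
  have "\<exists>!C. is_component (induced_subgraph \<Lambda> R) C \<and> gdist_set \<Lambda> v (verts C) \<le> 1" for v
  proof -
    obtain z where z: "z \<in> L" "v - z \<in> tile"
      using tile_surj by blast
    show ?thesis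
    proof (rule ex1I[of _ "induced_subgraph \<Lambda> (block z)"])
      show "is_component (induced_subgraph \<Lambda> R) (induced_subgraph \<Lambda> (block z)) \<and>
          gdist_set \<Lambda> v (verts (induced_subgraph \<Lambda> (block z))) \<le> 1"
        using z by (auto simp: is_component_R_iff verts gdist_set_block_le_iff)
      show "C = induced_subgraph \<Lambda> (block z)"
        if "is_component (induced_subgraph \<Lambda> R) C \<and> gdist_set \<Lambda> v (verts C) \<le> 1" for C
      proof -
        from that obtain z' where "z' \<in> L" "C = induced_subgraph \<Lambda> (block z')" "v - z' \<in> tile"
          by (auto simp: is_component_R_iff verts gdist_set_block_le_iff)
        then show ?thesis
          using z block_near_unique by blast
      qed
    qed
  qed
  moreover have "\<exists>!w. w \<in> verts C \<and> gdist \<Lambda> v w = gdist_set \<Lambda> v (verts C)"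
    if C: "is_component (induced_subgraph \<Lambda> R) C" "gdist_set \<Lambda> v (verts C) \<le> 1" for v C
  proof -
    obtain z where z: "z \<in> L" "C = induced_subgraph \<Lambda> (block z)"
      using C is_component_R_iff by blast
    show ?thesis
    proof (rule unique_nearest_vertex)
      show "verts C \<noteq> {}"
        using C by (auto simp: is_component_def gconnected_def)
      show "w = w'" if "v \<notin> verts C" "w \<in> verts C" "w' \<in> verts C"
        "{v, w} \<in> edges \<Lambda>" "{v, w'} \<in> edges \<Lambda>" for w w'
        using that block_nearest_unique by (auto simp: z verts edges_Lambda_iff)
    qed (use C in auto)
  qed
  ultimately show ?thesis
    unfolding PDDS_def one_enat_def[symmetric] by simp
qed

text \<open>The witnesses are the graph induced on \<open>Q\<close>, which is
  \<open>block 0\<close>, and the kernel \<open>L\<close>.\<close>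

lemma lattice_like_R: "lattice_like R"
proof -
  have "block 0 = Q"
    by (simp add: block_def)
  then have "induced_subgraph \<Lambda> (block z) = translate (induced_subgraph \<Lambda> (block 0)) z" for z
    by (simp add: translate_induced_Lambda block_def)
  moreover have "0 \<in> L"
    using lattice_L by (simp add: is_lattice_def)
  ultimately show ?thesis
    unfolding lattice_like_def is_component_R_iff using lattice_L by metis
qed

end

section \<open>Labelling the coordinate directions in dimension \<open>3 * k + 2\<close>\<close>

theorem theorem10:
  fixes k :: nat
  assumes "CARD('n::finite) = 3 * k + 2"
  shows "\<exists>R :: (int ^ 'n) set.
           PDDS 1 \<Lambda> R \<and>
           (\<forall>C. is_component (induced_subgraph \<Lambda> R) C \<longrightarrow>
              graph_iso C (path_graph 2 \<box> path_graph 2)) \<and>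
           lattice_like R"
proof -
  have "card (UNIV :: 'n set) \<ge> 2"
    using assms by simp
  then obtain i1 i2 :: 'n where i12: "i1 \<noteq> i2"
    by (metis card_2_iff obtain_subset_with_card_n)
  \<comment> \<open>There are as many directions outside the plane as labels, so any bijection
    between them serves.\<close>
  have "card (UNIV - {i1, i2}) = 3 * k"
    using i12 assms by (simp add: card_Diff_subset)
  moreover have "card ({0..2 :: int} \<times> {1..int k}) = 3 * k"
    by (simp add: card_cartesian_product)
  ultimately obtain l where l: "bij_betw l (UNIV - {i1, i2}) ({0..2 :: int} \<times> {1..int k})"
    using finite_same_card_bij[of "UNIV - {i1, i2}" "{0..2 :: int} \<times> {1..int k}"] by auto
  define c where "c i = (if i = i1 then 0 else if i = i2 then 1 else fst (l i))" for i
  define j where "j i = (if i = i1 \<or> i = i2 then 0 else snd (l i))" for i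
  have "bij_betw (\<lambda>i. (c i, j i)) (UNIV - {i1, i2}) ({0..2} \<times> {1..int k})"
    using l by (rule bij_betw_cong[THEN iffD1, rotated]) (auto simp: c_def j_def)
  then interpret square_tiling i1 i2 c j k
    using i12 by unfold_locales (auto simp: c_def j_def)
  show ?thesis
    using PDDS_R graph_iso_block lattice_like_R is_component_R_iff by metis
qed

end
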